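(* For any modal formula $\varphi$, the following are equivalent: (1) $\varphi$ is a theorem of $12$g; (2) $\varphi$ is valid in all quasi-$1$-planes; (3) $\varphi$ is valid in all connected quasi-$1$-planes; (4) $\varphi$ is valid in all $1$-planes; (5) $\varphi$ is valid in all projective $1$-planes; (6) $\varphi$ is valid in all non-degenerate projective $1$-planes.
   Context: Modal formulas are built from propositional variables with $\neg,\wedge,\Box$; $\Diamond=\neg\Box\neg$. A $1$-frame is $(X,I)$ with $I\subseteq X\times X$; a formula is valid in a $1$-frame if it is true at every point of every model (valuation) on it, with $\Box\varphi$ true at $a$ iff $\varphi$ is true at every $b$ with $aIb$. A normal logic contains all tautologies and instances of $\Box(\varphi\to\psi)\to(\Box\varphi\to\Box\psi)$ and is closed under modus ponens and necessitation; $12$g is the smallest normal logic containing all instances of $\Box\varphi\to\Diamond\varphi$, $\Diamond\Box\varphi\to\varphi$, $\Box\Box\varphi\to\Box\Box\Box\Box\varphi$. $I^n$ is $n$-fold composition of $I$. A quasi-$1$-plane is a $1$-frame with $I$ serial, symmetric, and $aI^4b\Rightarrow aI^2b$; it is connected if any two elements are joined by a finite $(I\cup I^{-1})$-path. A $1$-plane is a $1$-frame satisfying O1: $aI^4b\Rightarrow aI^2b$; O2: $aI^2b$ or $aI^3b$ for all $a,b$; O3: $aIbIcIdIa$ implies $a=c$ or $b=d$. In a $1$-plane $I^2$ is an equivalence relation; it is projective if there are exactly two $I^2$-classes, and non-degenerate if there exist $a,b,c,d,e,f$ with $aIbIcId$, $eIf$, not $aId$, and none of $a,b,c,d$ incident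 with $e$ or $f$. *)

theory Defs
  imports Main
begin

section \<open>Modal formulas and normal logics\<close>

datatype fm =
    Var nat
  | Neg fm
  | Conj fm fm
  | Box fm

abbreviation Imp :: "fm \<Rightarrow> fm \<Rightarrow> fm" where
  "Imp \<phi> \<psi> \<equiv> Neg (Conj \<phi> (Neg \<psi>))"

abbreviation Dia :: "fm \<Rightarrow> fm" where
  "Dia \<phi> \<equiv> Neg (Box (Neg \<phi>))"

text \<open>A tautology is a modal substitution instance of a propositional tautology, i.e. a formula
  true under every Boolean assignment that treats variables and boxed formulas as atoms.\<close>

fun prop_eval :: "(fm \<Rightarrow> bool) \<Rightarrow> fm \<Rightarrow> bool" where
  "prop_eval h (Var p) = h (Var p)"
| "prop_eval h (Neg \<phi>) = (\<not> prop_eval h \<phi>)"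
| "prop_eval h (Conj \<phi> \<psi>) = (prop_eval h \<phi> \<and> prop_eval h \<psi>)"
| "prop_eval h (Box \<phi>) = h (Box \<phi>)"

definition tautology :: "fm \<Rightarrow> bool" where
  "tautology \<phi> \<longleftrightarrow> (\<forall>h. prop_eval h \<phi>)"

definition normal_logic :: "fm set \<Rightarrow> bool" where
  "normal_logic L \<longleftrightarrow>
     (\<forall>\<phi>. tautology \<phi> \<longrightarrow> \<phi> \<in> L) \<and>
     (\<forall>\<phi> \<psi>. Imp (Box (Imp \<phi> \<psi>)) (Imp (Box \<phi>) (Box \<psi>)) \<in> L) \<and>
     (\<forall>\<phi> \<psi>. \<phi> \<in> L \<longrightarrow> Imp \<phi> \<psi> \<in> L \<longrightarrow> \<psi> \<in> L) \<and>
     (\<forall>\<phi>. \<phi> \<in> L \<longrightarrow> Box \<phi> \<in> L)"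

definition axioms_12g :: "fm set" where
  "axioms_12g =
     {Imp (Box \<phi>) (Dia \<phi>) | \<phi>. True} \<union>
     {Imp (Dia (Box \<phi>)) \<phi> | \<phi>. True} \<union>
     {Imp (Box (Box \<phi>)) (Box (Box (Box (Box \<phi>)))) | \<phi>. True}"

definition logic_12g :: "fm set" where
  "logic_12g = \<Inter>{L. normal_logic L \<and> axioms_12g \<subseteq> L}"

section \<open>Frames and validity\<close>

definition frame1 :: "'w set \<Rightarrow> 'w rel \<Rightarrow> bool" where
  "frame1 X I \<longleftrightarrow> I \<subseteq> X \<times> X"

fun sat :: "'w rel \<Rightarrow> (nat \<Rightarrow> 'w set) \<Rightarrow> 'w \<Rightarrow> fm \<Rightarrow> bool" where
  "sat I V a (Var p) = (a \<in> V p)"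
| "sat I V a (Neg \<phi>) = (\<not> sat I V a \<phi>)"
| "sat I V a (Conj \<phi> \<psi>) = (sat I V a \<phi> \<and> sat I V a \<psi>)"
| "sat I V a (Box \<phi>) = (\<forall>b. (a, b) \<in> I \<longrightarrow> sat I V b \<phi>)"

definition valid_on :: "'w set \<Rightarrow> 'w rel \<Rightarrow> fm \<Rightarrow> bool" where
  "valid_on X I \<phi> \<longleftrightarrow>
     (\<forall>V. (\<forall>p. V p \<subseteq> X) \<longrightarrow> (\<forall>a\<in>X. sat I V a \<phi>))"

text \<open>A class of frames is given by a predicate on carrier sets \<open>X :: 'w set\<close> and relations.
  HOL cannot quantify over types inside a formula, so the points come from a type \<open>'w\<close>,
  which results keep arbitrary.\<close>

definition valid_in :: "('w set \<Rightarrow> 'w rel \<Rightarrow> bool) \<Rightarrow> fm \<Rightarrow> bool" where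
  "valid_in K \<phi> \<longleftrightarrow> (\<forall>X I. K X I \<longrightarrow> valid_on X I \<phi>)"

section \<open>Quasi-1-planes and 1-planes\<close>

definition quasi_1_plane :: "'w set \<Rightarrow> 'w rel \<Rightarrow> bool" where
  "quasi_1_plane X I \<longleftrightarrow>
     frame1 X I \<and> (\<forall>a\<in>X. \<exists>b. (a, b) \<in> I) \<and> sym I \<and> I ^^ 4 \<subseteq> I ^^ 2"

definition connected_quasi_1_plane :: "'w set \<Rightarrow> 'w rel \<Rightarrow> bool" where
  "connected_quasi_1_plane X I \<longleftrightarrow>
     quasi_1_plane X I \<and> (\<forall>a\<in>X. \<forall>b\<in>X. (a, b) \<in> (I \<union> I\<inverse>)\<^sup>*)"

definition plane1 :: "'w set \<Rightarrow> 'w rel \<Rightarrow> bool" where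
  "plane1 X I \<longleftrightarrow>
     frame1 X I \<and>
     I ^^ 4 \<subseteq> I ^^ 2 \<and>
     (\<forall>a\<in>X. \<forall>b\<in>X. (a, b) \<in> I ^^ 2 \<or> (a, b) \<in> I ^^ 3) \<and>
     (\<forall>a b c d. (a, b) \<in> I \<and> (b, c) \<in> I \<and> (c, d) \<in> I \<and> (d, a) \<in> I \<longrightarrow> a = c \<or> b = d)"

definition projective_1_plane :: "'w set \<Rightarrow> 'w rel \<Rightarrow> bool" where
  "projective_1_plane X I \<longleftrightarrow> plane1 X I \<and> card (X // (I ^^ 2)) = 2"

definition nondegenerate :: "'w rel \<Rightarrow> bool" where
  "nondegenerate I \<longleftrightarrow>
     (\<exists>a b c d e f.
        (a, b) \<in> I \<and> (b, c) \<in> I \<and> (c, d) \<in> I \<and> (e, f) \<in> I \<and> (a, d) \<notin> I \<and>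
        (\<forall>x\<in>{a, b, c, d}. (x, e) \<notin> I \<and> (x, f) \<notin> I))"

definition nondegenerate_projective_1_plane :: "'w set \<Rightarrow> 'w rel \<Rightarrow> bool" where
  "nondegenerate_projective_1_plane X I \<longleftrightarrow> projective_1_plane X I \<and> nondegenerate I"

end

theory Submission
  imports Defs "HOL-Library.Countable"
begin

text \<open>Soundness is routine once O1--O3 are seen to force symmetry. For completeness, a
  non-theorem fails at some world of the canonical model, whose accessibility relation is serial,
  symmetric and satisfies O1. Take two copies of the component of that world, so that every edge
  changes the copy. Starting from a six-element non-degenerate configuration labelled by worlds,
  a projective plane is generated freely: each step adds one element incident with at most two old
  ones, either to join two unjoined elements of the same kind (their labels have a common
  successor) or to supply the world refuting a boxed formula. Since formulas are countable,
  countably many steps suffice, so the plane fits in any infinite type, although the canonical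
  model does not; incidence among old elements never changes, so O3 and non-degeneracy survive,
  and truth at an element is membership in its label.\<close>

section \<open>Soundness\<close>

lemma relpow_2_iff: "(a, b) \<in> R ^^ 2 \<longleftrightarrow> (\<exists>c. (a, c) \<in> R \<and> (c, b) \<in> R)"
  by (auto simp: numeral_2_eq_2)

lemma relpow_3_iff: "(a, b) \<in> R ^^ 3 \<longleftrightarrow> (\<exists>c d. (a, c) \<in> R \<and> (c, d) \<in> R \<and> (d, b) \<in> R)"
  by (auto simp: numeral_3_eq_3)

lemma relpow_4_iff:
  "(a, b) \<in> R ^^ 4 \<longleftrightarrow> (\<exists>c d e. (a, c) \<in> R \<and> (c, d) \<in> R \<and> (d, e) \<in> R \<and> (e, b) \<in> R)"
proof -
  have "R ^^ 4 = R ^^ 2 O R ^^ 2" using relpow_add[of 2 2 R] by simp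
  then show ?thesis by (auto simp: relpow_2_iff relcomp_unfold)
qed

text \<open>A point of a model is itself a Boolean assignment to variables and boxed formulas, so
  every tautology holds there.\<close>

lemma sat_iff_prop_eval: "sat I V a \<phi> \<longleftrightarrow> prop_eval (sat I V a) \<phi>"
  by (induction \<phi>) auto

text \<open>O2 for \<open>a\<close> with itself gives seriality. For symmetry, if \<open>b\<close>
  reaches \<open>a\<close> in three steps, an edge from \<open>a\<close> to \<open>b\<close> closes
  a quadrangle, and either alternative of O3 turns one of its edges into the reverse edge.\<close>

lemma plane1_imp_quasi_1_plane:
  assumes "plane1 X I"
  shows "quasi_1_plane X I"
proof -
  have fr: "I \<subseteq> X \<times> X" and o1: "\<And>a b. (a, b) \<in> I ^^ 4 \<Longrightarrow> (a, b) \<in> I ^^ 2"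
    and o2: "\<And>a b. a \<in> X \<Longrightarrow> b \<in> X \<Longrightarrow> (a, b) \<in> I ^^ 2 \<or> (a, b) \<in> I ^^ 3"
    and o3: "\<And>a b c d. (a, b) \<in> I \<Longrightarrow> (b, c) \<in> I \<Longrightarrow> (c, d) \<in> I \<Longrightarrow> (d, a) \<in> I \<Longrightarrow> a = c \<or> b = d"
    using assms unfolding plane1_def frame1_def by blast+
  have "\<exists>b. (a, b) \<in> I" if "a \<in> X" for a
    using o2[OF that that] unfolding relpow_2_iff relpow_3_iff by blast
  moreover have "(b, a) \<in> I" if ab: "(a, b) \<in> I" for a b
  proof -
    have "(b, a) \<in> I ^^ 3"
    proof (rule ccontr)
      assume no: "(b, a) \<notin> I ^^ 3"
      with o2[of b a] ab fr have "(b, a) \<in> I ^^ 2" by blast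
      then obtain c where c: "(b, c) \<in> I" "(c, a) \<in> I" unfolding relpow_2_iff by blast
      \<comment> \<open>The walk \<open>b, c, a, b, c\<close> goes once around the triangle;
        contracting it by O1 and appending the edge from \<open>c\<close> to \<open>a\<close> gives
        three steps after all.\<close>
      have "(b, c) \<in> I ^^ 4" using ab c unfolding relpow_4_iff by blast
      then obtain d where "(b, d) \<in> I" "(d, c) \<in> I" using o1 unfolding relpow_2_iff by blast
      with no c(2) show False unfolding relpow_3_iff by blast
    qed
    then obtain c d where cd: "(b, c) \<in> I" "(c, d) \<in> I" "(d, a) \<in> I"
      unfolding relpow_3_iff by blast
    from o3[OF ab this] cd show ?thesis by blast
  qed
  then have "sym I" by (rule symI)
  ultimately show ?thesis
    using assms unfolding quasi_1_plane_def plane1_def by simp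
qed

lemma plane1_imp_connected_quasi_1_plane:
  assumes "plane1 X I"
  shows "connected_quasi_1_plane X I"
proof -
  have "(a, b) \<in> (I \<union> I\<inverse>)\<^sup>*" if "a \<in> X" "b \<in> X" for a b
  proof -
    have "(a, b) \<in> I\<^sup>*"
      using assms that unfolding plane1_def by (meson relpow_imp_rtrancl)
    then show ?thesis by (meson UnI1 in_rtrancl_UnI)
  qed
  with plane1_imp_quasi_1_plane[OF assms] show ?thesis
    unfolding connected_quasi_1_plane_def by blast
qed

lemma normal_logic_valid_on:
  assumes "frame1 X I"
  shows "normal_logic {\<phi>. valid_on X I \<phi>}"
  unfolding normal_logic_def
proof (intro conjI allI impI)
  fix \<phi> assume "tautology \<phi>"
  then show "\<phi> \<in> {\<phi>. valid_on X I \<phi>}"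
    unfolding mem_Collect_eq valid_on_def tautology_def by (subst sat_iff_prop_eval) blast
next
  fix \<phi> \<psi>
  show "Imp (Box (Imp \<phi> \<psi>)) (Imp (Box \<phi>) (Box \<psi>)) \<in> {\<phi>. valid_on X I \<phi>}"
    unfolding mem_Collect_eq valid_on_def by (simp, blast)
next
  fix \<phi> \<psi>
  assume "\<phi> \<in> {\<phi>. valid_on X I \<phi>}" "Imp \<phi> \<psi> \<in> {\<phi>. valid_on X I \<phi>}"
  then show "\<psi> \<in> {\<phi>. valid_on X I \<phi>}" unfolding mem_Collect_eq valid_on_def by simp
next
  fix \<phi>
  assume "\<phi> \<in> {\<phi>. valid_on X I \<phi>}"
  moreover have "\<And>a b. (a, b) \<in> I \<Longrightarrow> b \<in> X" using assms unfolding frame1_def by blast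
  ultimately show "Box \<phi> \<in> {\<phi>. valid_on X I \<phi>}"
    unfolding mem_Collect_eq valid_on_def by simp
qed

text \<open>The three axiom schemes are matched, in order, by seriality, symmetry and O1.\<close>

lemma axioms_12g_valid_on:
  assumes "quasi_1_plane X I"
  shows "axioms_12g \<subseteq> {\<phi>. valid_on X I \<phi>}"
proof -
  have ser: "\<And>a. a \<in> X \<Longrightarrow> \<exists>b. (a, b) \<in> I"
    and sy: "\<And>a b. (a, b) \<in> I \<Longrightarrow> (b, a) \<in> I"
    and o1: "\<And>a b. (a, b) \<in> I ^^ 4 \<Longrightarrow> (a, b) \<in> I ^^ 2"
    using assms unfolding quasi_1_plane_def sym_def by blast+
  have "valid_on X I (Imp (Box \<phi>) (Dia \<phi>))" for \<phi>
    unfolding valid_on_def by (simp, use ser in blast)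
  moreover have "valid_on X I (Imp (Dia (Box \<phi>)) \<phi>)" for \<phi>
    unfolding valid_on_def using sy by (simp, blast)
  moreover have "valid_on X I (Imp (Box (Box \<phi>)) (Box (Box (Box (Box \<phi>)))))" for \<phi>
  proof -
    have "sat I V f \<phi>" if *: "\<forall>b. (a, b) \<in> I \<longrightarrow> (\<forall>c. (b, c) \<in> I \<longrightarrow> sat I V c \<phi>)"
      and "(a, c) \<in> I" "(c, d) \<in> I" "(d, e) \<in> I" "(e, f) \<in> I" for a c d e f V
    proof -
      from that(2-) have "(a, f) \<in> I ^^ 2" by (intro o1) (auto simp: relpow_4_iff)
      with * show ?thesis unfolding relpow_2_iff by blast
    qed
    then show ?thesis unfolding valid_on_def by (simp, blast)
  qed
  ultimately show ?thesis unfolding axioms_12g_def by blast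
qed

lemma logic_12g_sound:
  assumes "\<phi> \<in> logic_12g" "quasi_1_plane X I"
  shows "valid_on X I \<phi>"
proof -
  have "frame1 X I" using assms(2) unfolding quasi_1_plane_def by blast
  with normal_logic_valid_on axioms_12g_valid_on[OF assms(2)] assms(1) show ?thesis
    unfolding logic_12g_def by blast
qed

section \<open>The canonical model\<close>

locale normal_modal_logic =
  fixes L :: "fm set"
  assumes normal: "normal_logic L"
begin

text \<open>A theory describes truth at a single world, so it is closed under modus ponens but not
  under necessitation. Working with such theories avoids derivations from finite sets of
  premises.\<close>

definition mp_closed :: "fm set \<Rightarrow> bool" where
  "mp_closed T \<longleftrightarrow> L \<subseteq> T \<and> (\<forall>\<phi> \<psi>. \<phi> \<in> T \<longrightarrow> Imp \<phi> \<psi> \<in> T \<longrightarrow> \<psi> \<in> T)"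

definition world :: "fm set \<Rightarrow> bool" where
  "world u \<longleftrightarrow> mp_closed u \<and> (\<forall>\<phi>. Neg \<phi> \<in> u \<longleftrightarrow> \<phi> \<notin> u)"

definition canon :: "fm set rel" where
  "canon = {(u, v). world u \<and> world v \<and> (\<forall>\<phi>. Box \<phi> \<in> u \<longrightarrow> \<phi> \<in> v)}"

lemma tautology_in: "(\<And>h. prop_eval h \<phi>) \<Longrightarrow> \<phi> \<in> L"
  using normal unfolding normal_logic_def tautology_def by blast

lemma K_in: "Imp (Box (Imp \<phi> \<psi>)) (Imp (Box \<phi>) (Box \<psi>)) \<in> L"
  using normal unfolding normal_logic_def by blast

lemma necessitation: "\<phi> \<in> L \<Longrightarrow> Box \<phi> \<in> L"
  using normal unfolding normal_logic_def by blast

lemma mp_closed_L: "mp_closed L"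
  using normal unfolding normal_logic_def mp_closed_def by blast

lemma mp: "mp_closed T \<Longrightarrow> Imp \<phi> \<psi> \<in> T \<Longrightarrow> \<phi> \<in> T \<Longrightarrow> \<psi> \<in> T"
  unfolding mp_closed_def by blast

lemma mp_L: "mp_closed T \<Longrightarrow> Imp \<phi> \<psi> \<in> L \<Longrightarrow> \<phi> \<in> T \<Longrightarrow> \<psi> \<in> T"
  unfolding mp_closed_def by blast

text \<open>Propositional reasoning inside a theory is hereby reduced to a check over all Boolean
  assignments.\<close>

lemma taut_conseq:
  assumes "mp_closed T" "\<phi> \<in> T" "\<And>h. prop_eval h \<phi> \<Longrightarrow> prop_eval h \<psi>"
  shows "\<psi> \<in> T"
  by (rule mp_L[OF assms(1) _ assms(2)], rule tautology_in) (use assms(3) in auto)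

lemma taut_conseq2:
  assumes "mp_closed T" "\<phi> \<in> T" "\<chi> \<in> T" "\<And>h. prop_eval h \<phi> \<Longrightarrow> prop_eval h \<chi> \<Longrightarrow> prop_eval h \<psi>"
  shows "\<psi> \<in> T"
proof -
  have "Imp \<phi> (Imp \<chi> \<psi>) \<in> L" by (rule tautology_in) (use assms(4) in auto)
  then show ?thesis using mp_L mp assms by blast
qed

lemma box_mono:
  assumes "mp_closed T" "Box \<phi> \<in> T" "\<And>h. prop_eval h \<phi> \<Longrightarrow> prop_eval h \<psi>"
  shows "Box \<psi> \<in> T"
proof -
  have "Box (Imp \<phi> \<psi>) \<in> L" by (intro necessitation tautology_in) (use assms(3) in auto)
  then show ?thesis using mp_L[OF mp_closed_L K_in] mp_L assms by blast
qed

lemma box_mono2: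
  assumes "mp_closed T" "Box \<phi> \<in> T" "Box \<chi> \<in> T"
    and "\<And>h. prop_eval h \<phi> \<Longrightarrow> prop_eval h \<chi> \<Longrightarrow> prop_eval h \<psi>"
  shows "Box \<psi> \<in> T"
proof -
  have "Box (Imp \<chi> \<psi>) \<in> T" by (rule box_mono[OF assms(1,2)]) (use assms(4) in auto)
  then show ?thesis using mp_L[OF assms(1) K_in] mp assms by blast
qed

text \<open>Zorn's lemma yields a theory maximal among those omitting \<open>\<phi>\<close>. If it
  omitted both a formula and its negation, each of the two would imply \<open>\<phi>\<close> in it,
  and \<open>\<phi>\<close> would follow by cases.\<close>

lemma lindenbaum:
  assumes "mp_closed T" "\<phi> \<notin> T"
  obtains u where "world u" "T \<subseteq> u" "\<phi> \<notin> u"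
proof -
  let ?S = "{U. mp_closed U \<and> T \<subseteq> U \<and> \<phi> \<notin> U}"
  have "\<exists>M\<in>?S. \<forall>X\<in>?S. M \<subseteq> X \<longrightarrow> X = M"
  proof (rule subset_Zorn_nonempty)
    show "?S \<noteq> {}" using assms by blast
    fix C assume C: "C \<noteq> {}" "subset.chain ?S C"
    have CS: "C \<subseteq> ?S" using C(2) unfolding subset.chain_def by blast
    have "\<psi> \<in> \<Union>C" if "\<chi> \<in> \<Union>C" "Imp \<chi> \<psi> \<in> \<Union>C" for \<chi> \<psi>
    proof -
      from that obtain A B where AB: "A \<in> C" "B \<in> C" "\<chi> \<in> A" "Imp \<chi> \<psi> \<in> B" by blast
      then have "A \<subseteq> B \<or> B \<subseteq> A" using C(2) unfolding subset_chain_def by blast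
      then show ?thesis using AB CS mp by blast
    qed
    moreover have "L \<subseteq> \<Union>C" "T \<subseteq> \<Union>C" "\<phi> \<notin> \<Union>C"
      using C(1) CS unfolding mp_closed_def by blast+
    ultimately show "\<Union>C \<in> ?S" unfolding mp_closed_def by blast
  qed
  then obtain u where u: "mp_closed u" "T \<subseteq> u" "\<phi> \<notin> u"
    and max: "\<And>U. mp_closed U \<Longrightarrow> u \<subseteq> U \<Longrightarrow> \<phi> \<notin> U \<Longrightarrow> U = u"
    by (smt (verit) mem_Collect_eq subset_trans)
  have ext: "Imp \<psi> \<phi> \<in> u" if "\<psi> \<notin> u" for \<psi>
  proof (rule ccontr)
    assume no: "Imp \<psi> \<phi> \<notin> u"
    \<comment> \<open>This is the theory generated by \<open>u\<close> and \<open>\<psi>\<close>. As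
      it omits \<open>\<phi>\<close>, maximality makes it equal to \<open>u\<close>, although it
      contains \<open>\<psi>\<close>.\<close>
    let ?U = "{\<chi>. Imp \<psi> \<chi> \<in> u}"
    have "Imp \<psi> \<chi> \<in> u" if "\<chi> \<in> u" for \<chi> by (rule taut_conseq[OF u(1) that]) simp
    then have sub: "u \<subseteq> ?U" by blast
    have "\<psi>' \<in> ?U" if "\<chi> \<in> ?U" "Imp \<chi> \<psi>' \<in> ?U" for \<chi> \<psi>'
      using taut_conseq2[OF u(1), of "Imp \<psi> \<chi>" "Imp \<psi> (Imp \<chi> \<psi>')" "Imp \<psi> \<psi>'"] that
      unfolding mem_Collect_eq prop_eval.simps by blast
    then have "mp_closed ?U" using sub u(1) unfolding mp_closed_def by blast
    then have "?U = u" using no sub by (intro max) auto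
    moreover have "Imp \<psi> \<psi> \<in> L" by (rule tautology_in) simp
    then have "\<psi> \<in> ?U" using u(1) unfolding mp_closed_def by blast
    ultimately show False using that by blast
  qed
  have "Neg \<psi> \<in> u \<longleftrightarrow> \<psi> \<notin> u" for \<psi>
  proof
    assume "Neg \<psi> \<in> u"
    then show "\<psi> \<notin> u" using u(3) taut_conseq2[OF u(1) \<open>Neg \<psi> \<in> u\<close>, of \<psi> \<phi>] by auto
  next
    assume "\<psi> \<notin> u"
    moreover have "\<phi> \<in> u" if "Imp \<psi> \<phi> \<in> u" "Imp (Neg \<psi>) \<phi> \<in> u"
      by (rule taut_conseq2[OF u(1) that]) auto
    ultimately show "Neg \<psi> \<in> u" using u(3) ext by blast
  qed
  then have "world u" using u(1) unfolding world_def by blast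
  then show thesis using that u by blast
qed

lemma world_Conj:
  assumes "world u"
  shows "Conj \<phi> \<psi> \<in> u \<longleftrightarrow> \<phi> \<in> u \<and> \<psi> \<in> u"
proof -
  have u: "mp_closed u" using assms unfolding world_def by blast
  have "\<phi> \<in> u \<and> \<psi> \<in> u" if "Conj \<phi> \<psi> \<in> u"
    by (rule conjI; rule taut_conseq[OF u that]) auto
  moreover have "Conj \<phi> \<psi> \<in> u" if "\<phi> \<in> u" "\<psi> \<in> u"
    by (rule taut_conseq2[OF u that]) auto
  ultimately show ?thesis by blast
qed

lemma mp_closed_unbox:
  assumes "mp_closed u"
  shows "mp_closed {\<chi>. Box \<chi> \<in> u}"
proof -
  have "Box \<chi> \<in> u" if "\<chi> \<in> L" for \<chi>
    using assms necessitation[OF that] unfolding mp_closed_def by blast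
  moreover have "Box \<psi> \<in> u" if "Box \<phi> \<in> u" "Box (Imp \<phi> \<psi>) \<in> u" for \<phi> \<psi>
    using mp[OF assms mp_L[OF assms K_in that(2)] that(1)] .
  ultimately show ?thesis unfolding mp_closed_def by blast
qed

lemma canon_witness:
  assumes "world u" "Box \<psi> \<notin> u"
  obtains v where "(u, v) \<in> canon" "\<psi> \<notin> v"
proof -
  have "mp_closed {\<chi>. Box \<chi> \<in> u}" using assms(1) mp_closed_unbox unfolding world_def by blast
  then obtain v where "world v" "{\<chi>. Box \<chi> \<in> u} \<subseteq> v" "\<psi> \<notin> v"
    by (rule lindenbaum) (use assms(2) in auto)
  with that assms(1) show thesis unfolding canon_def by blast
qed

lemma Box_in_world_iff: "world u \<Longrightarrow> Box \<psi> \<in> u \<longleftrightarrow> (\<forall>v. (u, v) \<in> canon \<longrightarrow> \<psi> \<in> v)"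
  using canon_witness unfolding canon_def by blast

end

section \<open>Frame conditions satisfied by the canonical model\<close>

locale logic_above_12g = normal_modal_logic +
  assumes axioms_in: "axioms_12g \<subseteq> L"
begin

lemma canon_serial:
  assumes "world u"
  obtains v where "(u, v) \<in> canon"
proof -
  \<comment> \<open>Any tautology would do: the first axiom keeps the box of its negation out of
    \<open>u\<close>, and a missing box has a witnessing successor.\<close>
  let ?T = "Neg (Conj (Var 0) (Neg (Var 0)))"
  have u: "mp_closed u" using assms unfolding world_def by blast
  have "Box ?T \<in> L" by (intro necessitation tautology_in) simp
  then have T: "Box ?T \<in> u" using u unfolding mp_closed_def by blast
  have "Imp (Box (Neg ?T)) (Dia (Neg ?T)) \<in> L" using axioms_in unfolding axioms_12g_def by blast
  then have "Box (Neg ?T) \<in> u \<Longrightarrow> Neg (Box (Neg (Neg ?T))) \<in> u" using mp_L[OF u] by blast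
  moreover have "Box (Neg (Neg ?T)) \<in> u" by (rule box_mono[OF u T]) simp
  ultimately have "Box (Neg ?T) \<notin> u" using assms unfolding world_def by blast
  then show thesis using canon_witness assms that by blast
qed

text \<open>If \<open>Box \<phi>\<close> is in \<open>v\<close>, its negation cannot be boxed in
  \<open>u\<close>, so \<open>Dia (Box \<phi>)\<close> is in \<open>u\<close> and the second axiom
  yields \<open>\<phi>\<close>.\<close>

lemma canon_sym:
  assumes "(u, v) \<in> canon"
  shows "(v, u) \<in> canon"
proof -
  have w: "world u" "world v" using assms unfolding canon_def by auto
  have "\<phi> \<in> u" if "Box \<phi> \<in> v" for \<phi>
  proof -
    have "Imp (Dia (Box \<phi>)) \<phi> \<in> L" using axioms_in unfolding axioms_12g_def by blast
    moreover have "Box (Neg (Box \<phi>)) \<notin> u" using assms that w unfolding canon_def world_def by blast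
    ultimately show ?thesis using w(1) mp_L unfolding world_def by blast
  qed
  with w show ?thesis unfolding canon_def by blast
qed

text \<open>A common successor must contain everything boxed in \<open>u\<close> or in
  \<open>v\<close>. If these demands clashed, some \<open>\<delta>\<close> boxed in \<open>v\<close>
  would have its negation boxed in \<open>u\<close>; symmetry then puts
  \<open>Box (Box (Neg (Box \<delta>)))\<close> into \<open>u\<close>, and the third axiom carries
  \<open>Neg (Box \<delta>)\<close> along the four steps to \<open>v\<close>.\<close>

lemma canon_relpow_4: "canon ^^ 4 \<subseteq> canon ^^ 2"
proof (rule subrelI)
  fix u v assume "(u, v) \<in> canon ^^ 4"
  then obtain a b c where uv: "(u, a) \<in> canon" "(a, b) \<in> canon" "(b, c) \<in> canon" "(c, v) \<in> canon"
    unfolding relpow_4_iff by blast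
  then have w: "world u" "world v" unfolding canon_def by auto
  then have mu: "mp_closed u" and mv: "mp_closed v" unfolding world_def by auto
  have two: "\<phi> \<in> v" if "Box (Box \<phi>) \<in> u" for \<phi>
  proof -
    have "Imp (Box (Box \<phi>)) (Box (Box (Box (Box \<phi>)))) \<in> L"
      using axioms_in unfolding axioms_12g_def by blast
    then have "Box (Box (Box (Box \<phi>))) \<in> u" using that mp_L mu by blast
    then show ?thesis using uv unfolding canon_def by blast
  qed
  \<comment> \<open>By symmetry, a common successor of \<open>u\<close> and \<open>v\<close> suffices.\<close>
  let ?T = "{\<chi>. \<exists>\<delta>. Box \<delta> \<in> v \<and> Box (Imp \<delta> \<chi>) \<in> u}"
  let ?F = "Conj (Var 0) (Neg (Var 0))"
  have triv: "Box \<chi> \<in> u" "Box \<chi> \<in> v" if "\<chi> \<in> L" for \<chi>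
    using necessitation[OF that] mu mv unfolding mp_closed_def by auto
  have Tu: "\<chi> \<in> ?T" if "Box \<chi> \<in> u" for \<chi>
  proof -
    have "Box (Neg ?F) \<in> v" by (intro triv tautology_in) simp
    moreover have "Box (Imp (Neg ?F) \<chi>) \<in> u" by (rule box_mono[OF mu that]) simp
    ultimately show ?thesis by blast
  qed
  have Tv: "\<chi> \<in> ?T" if "Box \<chi> \<in> v" for \<chi>
  proof -
    have "Box (Imp \<chi> \<chi>) \<in> u" by (intro triv tautology_in) simp
    with that show ?thesis by blast
  qed
  have "mp_closed ?T"
    unfolding mp_closed_def
  proof (intro conjI allI impI)
    show "L \<subseteq> ?T" using triv Tu by blast
    fix \<phi> \<psi> assume "\<phi> \<in> ?T" "Imp \<phi> \<psi> \<in> ?T"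
    then obtain \<delta> \<epsilon> where d: "Box \<delta> \<in> v" "Box (Imp \<delta> \<phi>) \<in> u"
      and e: "Box \<epsilon> \<in> v" "Box (Imp \<epsilon> (Imp \<phi> \<psi>)) \<in> u" by blast
    \<comment> \<open>Boxed formulas are closed under conjunction, which is why a single
      \<open>\<delta>\<close> suffices in \<open>?T\<close>.\<close>
    have "Box (Conj \<delta> \<epsilon>) \<in> v" by (rule box_mono2[OF mv d(1) e(1)]) simp
    moreover have "Box (Imp (Conj \<delta> \<epsilon>) \<psi>) \<in> u" by (rule box_mono2[OF mu d(2) e(2)]) auto
    ultimately show "\<psi> \<in> ?T" by blast
  qed
  moreover have "?F \<notin> ?T"
  proof
    assume "?F \<in> ?T"
    then obtain \<delta> where d: "Box \<delta> \<in> v" "Box (Imp \<delta> ?F) \<in> u" by blast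
    have nd: "Box (Neg \<delta>) \<in> u" by (rule box_mono[OF mu d(2)]) auto
    have "Neg (Box \<delta>) \<in> z" if "(u, y) \<in> canon" "(y, z) \<in> canon" for y z
    proof -
      have "Neg \<delta> \<in> y" using nd that(1) unfolding canon_def by blast
      then have "\<delta> \<notin> y" using that(1) unfolding canon_def world_def by blast
      then have "Box \<delta> \<notin> z" using canon_sym[OF that(2)] unfolding canon_def by blast
      then show ?thesis using that(2) unfolding canon_def world_def by blast
    qed
    moreover have "world y" if "(u, y) \<in> canon" for y using that unfolding canon_def by blast
    ultimately have "Box (Box (Neg (Box \<delta>))) \<in> u" using Box_in_world_iff w(1) by simp
    then show False using two d(1) w(2) unfolding world_def by blast
  qed
  ultimately obtain m where "world m" "?T \<subseteq> m" by (rule lindenbaum)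
  then have "(u, m) \<in> canon" "(v, m) \<in> canon" using Tu Tv w unfolding canon_def by blast+
  then show "(u, v) \<in> canon ^^ 2" using canon_sym unfolding relpow_2_iff by blast
qed

end

section \<open>Free completion of finite labelled configurations\<close>

type_synonym ('w, 'm) config = "'w set \<times> 'w rel \<times> ('w \<Rightarrow> 'm)"

text \<open>Elements are drawn from the range of \<open>e\<close> and labelled by \<open>W\<close>; \<open>side\<close> separates points from
  lines, and \<open>h k u\<close> is the \<open>k\<close>-th label that a neighbour of an element labelled \<open>u\<close> must realise.\<close>

locale bipartite_labels =
  fixes e :: "nat \<Rightarrow> 'w" and W :: "'m set" and J :: "'m rel"
    and side :: "'m \<Rightarrow> bool" and h :: "nat \<Rightarrow> 'm \<Rightarrow> 'm"
  assumes inj_e: "inj e"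
    and J_W: "J \<subseteq> W \<times> W"
    and J_sym: "sym J"
    and J_side: "(u, v) \<in> J \<Longrightarrow> side v \<longleftrightarrow> \<not> side u"
    and J_common: "u \<in> W \<Longrightarrow> v \<in> W \<Longrightarrow> side u = side v \<Longrightarrow> \<exists>w. (u, w) \<in> J \<and> (v, w) \<in> J"
    and h_J: "u \<in> W \<Longrightarrow> (u, h k u) \<in> J"
begin

text \<open>These are the invariants of a stage: labels form a homomorphism into \<open>J\<close>,
  the last clause is O3, and finiteness guarantees a fresh element in the range of
  \<open>e\<close>.\<close>

fun good :: "('w, 'm) config \<Rightarrow> bool" where
  "good (D, I, f) \<longleftrightarrow> finite D \<and> D \<subseteq> range e \<and> I \<subseteq> D \<times> D \<and> sym I \<and> f ` D \<subseteq> W \<and>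
     (\<forall>a b. (a, b) \<in> I \<longrightarrow> (f a, f b) \<in> J) \<and>
     (\<forall>a b c d. (a, b) \<in> I \<and> (b, c) \<in> I \<and> (c, d) \<in> I \<and> (d, a) \<in> I \<longrightarrow> a = c \<or> b = d)"

text \<open>Incidence among old elements is kept exactly rather than merely enlarged, so that
  non-incidences persist too.\<close>

fun extends :: "('w, 'm) config \<Rightarrow> ('w, 'm) config \<Rightarrow> bool" where
  "extends (D, I, f) (D', I', f') \<longleftrightarrow>
     D \<subseteq> D' \<and> I' \<inter> D \<times> D = I \<and> (\<forall>a\<in>D. f' a = f a)"

lemma extends_refl: "good S \<Longrightarrow> extends S S"
  by (cases S) (simp, blast)

lemma extends_trans:
  assumes "extends S T" "extends T U"
  shows "extends S U"
proof -
  obtain D I f where S: "S = (D, I, f)" by (cases S)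
  obtain D' I' f' where T: "T = (D', I', f')" by (cases T)
  obtain D'' I'' f'' where U: "U = (D'', I'', f'')" by (cases U)
  have st: "D \<subseteq> D'" "I' \<inter> D \<times> D = I" "\<forall>a\<in>D. f' a = f a"
    and tu: "D' \<subseteq> D''" "I'' \<inter> D' \<times> D' = I'" "\<forall>a\<in>D'. f'' a = f' a"
    using assms unfolding S T U by simp_all
  have "D \<subseteq> D''" using st(1) tu(1) by blast
  moreover have "I'' \<inter> D \<times> D = I" using st(1,2) tu(2) by blast
  moreover have "\<forall>a\<in>D. f'' a = f a" using st(1,3) tu(3) by (metis subsetD)
  ultimately show ?thesis unfolding S U by simp
qed

text \<open>A quadrangle through the new element uses two members of \<open>A\<close> with a common
  old neighbour; the last assumption makes these two equal.\<close>

lemma good_insert: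
  assumes "good (D, I, f)" "A \<subseteq> D" "m \<in> W" "\<And>a. a \<in> A \<Longrightarrow> (f a, m) \<in> J"
    and "\<And>a b c. a \<in> A \<Longrightarrow> b \<in> A \<Longrightarrow> (a, c) \<in> I \<Longrightarrow> (c, b) \<in> I \<Longrightarrow> a = b"
  obtains D' I' f' c where "good (D', I', f')" "extends (D, I, f) (D', I', f')"
    "f' c = m" "\<And>a. a \<in> A \<Longrightarrow> (a, c) \<in> I'"
proof -
  have g: "finite D" "I \<subseteq> D \<times> D" "sym I" "f ` D \<subseteq> W" "\<And>a b. (a, b) \<in> I \<Longrightarrow> (f a, f b) \<in> J"
    and De: "D \<subseteq> range e"
    and o3: "\<And>a b c d. (a, b) \<in> I \<Longrightarrow> (b, c) \<in> I \<Longrightarrow> (c, d) \<in> I \<Longrightarrow> (d, a) \<in> I \<Longrightarrow> a = c \<or> b = d"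
    using assms(1) by simp_all
  have "infinite (range e)" using inj_e finite_imageD by blast
  then obtain n where n: "n \<notin> D" "n \<in> range e" using g(1) by (meson finite_subset subsetI)
  let ?D = "insert n D" and ?I = "I \<union> A \<times> {n} \<union> {n} \<times> A" and ?f = "f(n := m)"
  have nI: "(n, z) \<notin> I" "(z, n) \<notin> I" for z using n g(2) by auto
  have nA: "n \<notin> A" using n assms(2) by blast
  have old: "?f a = f a" if "a \<in> D" for a using that n by auto
  have flip: "(b, a) \<in> ?I" if "(a, b) \<in> ?I" for a b using that g(3) unfolding sym_def by blast
  have hom: "(?f a, ?f b) \<in> J" if ab: "(a, b) \<in> ?I" for a b
  proof -
    consider "(a, b) \<in> I" | "a \<in> A" "b = n" | "a = n" "b \<in> A" using ab by blast
    then show ?thesis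
    proof cases
      case 1
      with g(2,5) old show ?thesis by (metis SigmaE2 subsetD)
    next
      case 2
      with assms(2,4) old show ?thesis by (metis fun_upd_same subsetD)
    next
      case 3
      with assms(2,4) old J_sym show ?thesis by (metis fun_upd_same subsetD symD)
    qed
  qed
  have quad: "a = c \<or> b = d"
    if q: "(a, b) \<in> ?I" "(b, c) \<in> ?I" "(c, d) \<in> ?I" "(d, a) \<in> ?I" for a b c d
  proof -
    \<comment> \<open>A closed walk meeting \<open>n\<close> can be rotated to start there. If the
      opposite vertex is also \<open>n\<close>, the other alternative of O3 holds outright.\<close>
    have key: "y = w" if "(n, y) \<in> ?I" "(y, z) \<in> ?I" "(z, w) \<in> ?I" "(w, n) \<in> ?I" "z \<noteq> n" for y z w
    proof -
      have "y \<in> A" "w \<in> A" using that nI by auto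
      then have "(y, z) \<in> I" "(z, w) \<in> I" using that nA by auto
      with \<open>y \<in> A\<close> \<open>w \<in> A\<close> assms(5) show ?thesis by blast
    qed
    show ?thesis
    proof (cases "n \<in> {a, b, c, d}")
      case True
      then show ?thesis
        using q key[of b c d] key[of c d a] key[of d a b] key[of a b c] by blast
    next
      case False
      then show ?thesis using q o3[of a b c d] by auto
    qed
  qed
  have "good (?D, ?I, ?f)"
    unfolding good.simps
  proof (intro conjI allI impI)
    show "sym ?I" using flip by (rule symI)
    show "?I \<subseteq> ?D \<times> ?D" using g(2) assms(2) by blast
    show "?f ` ?D \<subseteq> W" using g(4) assms(3) by auto
    show "(?f a, ?f b) \<in> J" if "(a, b) \<in> ?I" for a b using hom that .
    show "a = c \<or> b = d"
      if "(a, b) \<in> ?I \<and> (b, c) \<in> ?I \<and> (c, d) \<in> ?I \<and> (d, a) \<in> ?I" for a b c d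
      using that by (elim conjE) (rule quad)
  qed (use g(1) n(2) De in auto)
  moreover have "extends (D, I, f) (?D, ?I, ?f)" using n(1) g(2) assms(2) by auto
  ultimately show thesis by (rule that[of ?D ?I ?f n]) simp_all
qed

text \<open>The condition is vacuous while an element is absent, so tasks can be scheduled for the
  whole range of \<open>e\<close> in advance. The price is that it passes to extensions only for
  elements already present.\<close>

definition joined :: "'w \<Rightarrow> 'w \<Rightarrow> ('w, 'm) config \<Rightarrow> bool" where
  "joined a b = (\<lambda>(D, I, f). a \<in> D \<and> b \<in> D \<and> side (f a) = side (f b) \<longrightarrow>
     (\<exists>c. (a, c) \<in> I \<and> (c, b) \<in> I))"

definition witnessed :: "'w \<Rightarrow> nat \<Rightarrow> ('w, 'm) config \<Rightarrow> bool" where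
  "witnessed a k = (\<lambda>(D, I, f). a \<in> D \<longrightarrow> (\<exists>c. (a, c) \<in> I \<and> f c = h k (f a)))"

lemma extend_joined:
  assumes "good S"
  shows "\<exists>T. good T \<and> extends S T \<and> joined a b T"
proof (cases "joined a b S")
  case True
  then show ?thesis using assms extends_refl by blast
next
  case False
  obtain D I f where S: "S = (D, I, f)" by (cases S)
  from False have ab: "a \<in> D" "b \<in> D" "side (f a) = side (f b)"
    and no: "\<And>c. (a, c) \<in> I \<Longrightarrow> (c, b) \<notin> I" unfolding S joined_def by auto
  have "sym I" "f ` D \<subseteq> W" using assms S by auto
  then obtain m where m: "(f a, m) \<in> J" "(f b, m) \<in> J" using J_common ab by blast
  have "m \<in> W" using m(1) J_W by blast
  \<comment> \<open>A new common neighbour is added only when there is none, which is exactly the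
    side condition of \<open>good_insert\<close>.\<close>
  have "x = y" if "x \<in> {a, b}" "y \<in> {a, b}" "(x, z) \<in> I" "(z, y) \<in> I" for x y z
    using that no symD[OF \<open>sym I\<close>] by blast
  moreover have "(f x, m) \<in> J" if "x \<in> {a, b}" for x using that m by blast
  moreover have "good (D, I, f)" "{a, b} \<subseteq> D" using assms S ab by auto
  ultimately obtain D' I' f' c where *: "good (D', I', f')" "extends (D, I, f) (D', I', f')"
    and c: "\<And>x. x \<in> {a, b} \<Longrightarrow> (x, c) \<in> I'"
    using good_insert[of D I f "{a, b}" m] \<open>m \<in> W\<close> by (metis (no_types, lifting))
  have "sym I'" using *(1) by simp
  then have "joined a b (D', I', f')" using c unfolding joined_def sym_def by blast
  with * S show ?thesis by blast
qed

lemma extend_witnessed: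
  assumes "good S"
  shows "\<exists>T. good T \<and> extends S T \<and> witnessed a k T"
proof (cases "witnessed a k S")
  case True
  then show ?thesis using assms extends_refl by blast
next
  case False
  obtain D I f where S: "S = (D, I, f)" by (cases S)
  from False have a: "a \<in> D" unfolding S witnessed_def by auto
  then have m: "(f a, h k (f a)) \<in> J" using h_J assms unfolding S by auto
  then have "h k (f a) \<in> W" using J_W by blast
  moreover have "x = y" if "x \<in> {a}" "y \<in> {a}" for x y using that by blast
  moreover have "(f x, h k (f a)) \<in> J" if "x \<in> {a}" for x using that m by blast
  moreover have "good (D, I, f)" "{a} \<subseteq> D" using assms S a by auto
  ultimately obtain D' I' f' c where *: "good (D', I', f')" "extends (D, I, f) (D', I', f')"
    and c: "f' c = h k (f a)" "(a, c) \<in> I'"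
    using good_insert[of D I f "{a}" "h k (f a)"] by (metis (no_types, lifting) insertI1)
  then have "witnessed a k (D', I', f')" using a unfolding witnessed_def by auto
  with * S show ?thesis by blast
qed

lemma joined_extends:
  assumes "joined a b S" "extends S T" "a \<in> fst S" "b \<in> fst S"
  shows "joined a b T"
proof -
  obtain D I f where S: "S = (D, I, f)" by (cases S)
  obtain D' I' f' where T: "T = (D', I', f')" by (cases T)
  have "I \<subseteq> I'" "f' a = f a" "f' b = f b" using assms unfolding S T by auto
  then show ?thesis using assms(1,3,4) unfolding joined_def S T by auto
qed

lemma extend_joined_witnessed:
  assumes "good S"
  shows "\<exists>T. good T \<and> extends S T \<and> (a \<in> fst S \<longrightarrow> b \<in> fst S \<longrightarrow> joined a b T) \<and> witnessed a k T"
proof -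
  obtain U where U: "good U" "extends S U" "joined a b U" using extend_joined[OF assms] by blast
  obtain T where T: "good T" "extends U T" "witnessed a k T" using extend_witnessed[OF U(1)] by blast
  have "fst S \<subseteq> fst U" using U(2) by (cases S; cases U) simp
  then have "a \<in> fst S \<longrightarrow> b \<in> fst S \<longrightarrow> joined a b T" using joined_extends[OF U(3) T(2)] by blast
  with T extends_trans[OF U(2) T(2)] show ?thesis by blast
qed

text \<open>The union of a chain of stages inherits the invariants, since finitely many edges
  already occur in one stage. Each task is met after its elements have appeared, so no demand stays
  open.\<close>

lemma free_completion:
  assumes "good (D0, I0, f0)"
  obtains X I f where "D0 \<subseteq> X" "I \<inter> D0 \<times> D0 = I0" "\<forall>a\<in>D0. f a = f0 a"
    and "I \<subseteq> X \<times> X" "f ` X \<subseteq> W" "\<forall>a b. (a, b) \<in> I \<longrightarrow> (f a, f b) \<in> J"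
    and "\<forall>a b c d. (a, b) \<in> I \<longrightarrow> (b, c) \<in> I \<longrightarrow> (c, d) \<in> I \<longrightarrow> (d, a) \<in> I \<longrightarrow> a = c \<or> b = d"
    and "\<forall>a\<in>X. \<forall>b\<in>X. side (f a) = side (f b) \<longrightarrow> (\<exists>c. (a, c) \<in> I \<and> (c, b) \<in> I)"
    and "\<forall>a\<in>X. \<forall>k. \<exists>c. (a, c) \<in> I \<and> f c = h k (f a)"
proof -
  \<comment> \<open>The spare component of the pairing makes every task recur at arbitrarily late stages.\<close>
  define task where "task n = (let (i, q) = prod_decode (fst (prod_decode n)); (j, k) = prod_decode q
    in (e i, e j, k))" for n
  have task: "\<exists>n\<ge>N. task n = (e i, e j, k)" for i j k N
    by (rule exI[of _ "prod_encode (prod_encode (i, prod_encode (j, k)), N)"])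
      (simp add: task_def le_prod_encode_2)
  define handles where "handles n (S :: ('w, 'm) config) T \<longleftrightarrow> (case task n of (a, b, k) \<Rightarrow>
    (a \<in> fst S \<longrightarrow> b \<in> fst S \<longrightarrow> joined a b T) \<and> witnessed a k T)" for n S T
  \<comment> \<open>Dependent choice builds the chain; the clause for \<open>n = 0\<close> pins its
    first stage.\<close>
  have "\<exists>S. \<forall>n. (good (S n) \<and> (n = 0 \<longrightarrow> S n = (D0, I0, f0))) \<and>
      (extends (S n) (S (Suc n)) \<and> handles n (S n) (S (Suc n)))"
  proof (rule dependent_nat_choice)
    show "\<exists>S. good S \<and> ((0::nat) = 0 \<longrightarrow> S = (D0, I0, f0))" using assms by blast
    fix S and n :: nat assume "good S \<and> (n = 0 \<longrightarrow> S = (D0, I0, f0))"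
    then show "\<exists>T. (good T \<and> (Suc n = 0 \<longrightarrow> T = (D0, I0, f0))) \<and> extends S T \<and> handles n S T"
      using extend_joined_witnessed[of S] unfolding handles_def by (cases "task n") simp
  qed
  then obtain S where S: "\<And>n. good (S n)" "S 0 = (D0, I0, f0)"
    "\<And>n. extends (S n) (S (Suc n))" "\<And>n. handles n (S n) (S (Suc n))" by blast
  define D R F where "D n = fst (S n)" and "R n = fst (snd (S n))" and "F n = snd (snd (S n))" for n
  have Sn: "S n = (D n, R n, F n)" for n unfolding D_def R_def F_def by simp
  have gd: "D n \<subseteq> range e" "R n \<subseteq> D n \<times> D n" "sym (R n)" "F n ` D n \<subseteq> W"
    "(a, b) \<in> R n \<Longrightarrow> (F n a, F n b) \<in> J"
    "(a, b) \<in> R n \<Longrightarrow> (b, c) \<in> R n \<Longrightarrow> (c, d) \<in> R n \<Longrightarrow> (d, a) \<in> R n \<Longrightarrow> a = c \<or> b = d"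
    for n a b c d using S(1)[of n] unfolding Sn by simp_all
  note RD = gd(2)
  have ext: "extends (S m) (S n)" if "m \<le> n" for m n
    using that by (induction rule: dec_induct) (use S extends_refl extends_trans in blast)+
  have DD: "D m \<subseteq> D n" and RR: "R n \<inter> D m \<times> D m = R m" and FF: "a \<in> D m \<Longrightarrow> F n a = F m a"
    if "m \<le> n" for m n a using ext[OF that] unfolding Sn by auto
  have Rm: "R m \<subseteq> R n" if "m \<le> n" for m n using RR[OF that] by blast
  \<comment> \<open>Labels never change once assigned, so the first stage containing an element
    determines its label.\<close>
  define X I f where "X = (\<Union>n. D n)" and "I = (\<Union>n. R n)" and "f a = F (LEAST n. a \<in> D n) a" for a
  have f: "f a = F n a" if "a \<in> D n" for a n
    using FF[of "LEAST n. a \<in> D n" n a] LeastI[of "\<lambda>n. a \<in> D n", OF that]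
      Least_le[of "\<lambda>n. a \<in> D n", OF that] unfolding f_def by simp
  \<comment> \<open>Later stages add no incidence between elements of stage \<open>n\<close>; for
    \<open>n = 0\<close> this preserves the starting configuration exactly.\<close>
  have ID: "I \<inter> D n \<times> D n = R n" for n
  proof
    show "R n \<subseteq> I \<inter> D n \<times> D n" using RD unfolding I_def by blast
    have "R m \<inter> D n \<times> D n \<subseteq> R n" for m
      using RR[of n m] Rm[of m n] by (cases "n \<le> m") auto
    then show "I \<inter> D n \<times> D n \<subseteq> R n" unfolding I_def by blast
  qed
  have common: "\<exists>n. a \<in> D n \<and> b \<in> D n" if "a \<in> X" "b \<in> X" for a b
  proof -
    from that obtain m n where "a \<in> D m" "b \<in> D n" unfolding X_def by blast
    then have "a \<in> D (max m n)" "b \<in> D (max m n)" using DD[of m "max m n"] DD[of n "max m n"] by auto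
    then show ?thesis by blast
  qed
  have e_ex: "\<exists>i. a = e i" if "a \<in> X" for a using that gd(1) unfolding X_def by blast
  have hd: "\<exists>n. a \<in> D n \<and> b \<in> D n \<and> joined a b (S (Suc n)) \<and> witnessed a k (S (Suc n))"
    if ab: "a \<in> X" "b \<in> X" for a b k
  proof -
    obtain N where N: "a \<in> D N" "b \<in> D N" using common ab by blast
    obtain i j where ij: "a = e i" "b = e j" using e_ex ab by blast
    obtain n where n: "N \<le> n" "task n = (a, b, k)" using task[of N i j k] unfolding ij by blast
    then have "a \<in> D n" "b \<in> D n" using N DD by blast+
    then show ?thesis using S(4)[of n] n(2) unfolding handles_def D_def by auto
  qed
  show thesis
  proof (rule that[of X I f]; (intro allI ballI impI)?)
    have "D 0 = D0" "R 0 = I0" "F 0 = f0" unfolding D_def R_def F_def S(2) by simp_all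
    then show "D0 \<subseteq> X" "I \<inter> D0 \<times> D0 = I0" "\<And>a. a \<in> D0 \<Longrightarrow> f a = f0 a"
      using ID[of 0] f[of _ 0] unfolding X_def by blast+
    show "I \<subseteq> X \<times> X" using RD unfolding X_def I_def by blast
    show "f ` X \<subseteq> W" using gd(4) f unfolding X_def by (auto simp: image_subset_iff)
  next
    fix a b assume "(a, b) \<in> I"
    then obtain n where n: "(a, b) \<in> R n" unfolding I_def by blast
    then have "a \<in> D n" "b \<in> D n" using RD by blast+
    then show "(f a, f b) \<in> J" using gd(5)[OF n] f[of a n] f[of b n] by simp
  next
    fix a b c d assume q: "(a, b) \<in> I" "(b, c) \<in> I" "(c, d) \<in> I" "(d, a) \<in> I"
    then obtain i j k l where "(a, b) \<in> R i" "(b, c) \<in> R j" "(c, d) \<in> R k" "(d, a) \<in> R l"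
      unfolding I_def by blast
    moreover define n where "n = max (max i j) (max k l)"
    moreover have "i \<le> n" "j \<le> n" "k \<le> n" "l \<le> n" unfolding n_def by simp_all
    ultimately have "(a, b) \<in> R n" "(b, c) \<in> R n" "(c, d) \<in> R n" "(d, a) \<in> R n"
      using Rm by blast+
    then show "a = c \<or> b = d" by (rule gd(6))
  next
    fix a b assume ab: "a \<in> X" "b \<in> X" "side (f a) = side (f b)"
    then obtain n where n: "a \<in> D n" "b \<in> D n" "joined a b (S (Suc n))" using hd by blast
    then have D: "a \<in> D (Suc n)" "b \<in> D (Suc n)" using DD[of n "Suc n"] by auto
    with n(3) obtain c where "(a, c) \<in> R (Suc n)" "(c, b) \<in> R (Suc n)"
      using ab(3) f[OF D(1)] f[OF D(2)] unfolding joined_def Sn by auto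
    then show "\<exists>c. (a, c) \<in> I \<and> (c, b) \<in> I" unfolding I_def by blast
  next
    fix a k assume a: "a \<in> X"
    then obtain n where n: "a \<in> D n" "witnessed a k (S (Suc n))" using hd by blast
    then have aD: "a \<in> D (Suc n)" using DD[of n "Suc n"] by auto
    then obtain c where c: "(a, c) \<in> R (Suc n)" "F (Suc n) c = h k (F (Suc n) a)"
      using n(2) unfolding witnessed_def Sn by auto
    then have "c \<in> D (Suc n)" using RD by blast
    then show "\<exists>c. (a, c) \<in> I \<and> f c = h k (f a)" using c f[OF aD] f[of c "Suc n"] unfolding I_def by auto
  qed
qed

end

section \<open>Completeness\<close>

text \<open>Two steps preserve the side, and elements of one side are two steps apart, so the
  \<open>I ^^ 2\<close>-classes are the two sides, inhabited by \<open>p\<close> and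
  \<open>q\<close>. For O2 across sides, one arbitrary step reduces to the case of equal
  sides.\<close>

lemma projective_1_plane_if_sides:
  fixes s :: "'w \<Rightarrow> bool"
  assumes fr: "I \<subseteq> X \<times> X"
    and flip: "\<And>a b. (a, b) \<in> I \<Longrightarrow> s b \<longleftrightarrow> \<not> s a"
    and serial: "\<And>a. a \<in> X \<Longrightarrow> \<exists>b. (a, b) \<in> I"
    and common: "\<And>a b. a \<in> X \<Longrightarrow> b \<in> X \<Longrightarrow> s a = s b \<Longrightarrow> \<exists>c. (a, c) \<in> I \<and> (c, b) \<in> I"
    and o3: "\<And>a b c d. (a, b) \<in> I \<Longrightarrow> (b, c) \<in> I \<Longrightarrow> (c, d) \<in> I \<Longrightarrow> (d, a) \<in> I \<Longrightarrow> a = c \<or> b = d"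
    and p: "p \<in> X" "\<not> s p" and q: "q \<in> X" "s q"
  shows "projective_1_plane X I"
proof -
  have I2: "(a, b) \<in> I ^^ 2 \<longleftrightarrow> a \<in> X \<and> b \<in> X \<and> s a = s b" for a b
    unfolding relpow_2_iff using fr flip common by blast
  have "(a, b) \<in> I ^^ 2" if ab: "(a, b) \<in> I ^^ 4" for a b
  proof -
    obtain c d e where "(a, c) \<in> I" "(c, d) \<in> I" "(d, e) \<in> I" "(e, b) \<in> I"
      using ab unfolding relpow_4_iff by blast
    then have "a \<in> X" "b \<in> X" "s a = s b" using fr flip by blast+
    then show ?thesis unfolding I2 by blast
  qed
  then have "I ^^ 4 \<subseteq> I ^^ 2" by (rule subrelI)
  moreover have "(a, b) \<in> I ^^ 2 \<or> (a, b) \<in> I ^^ 3" if ab: "a \<in> X" "b \<in> X" for a b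
  proof (cases "s a = s b")
    case True
    with ab show ?thesis unfolding I2 by blast
  next
    case False
    obtain c where c: "(a, c) \<in> I" using serial ab by blast
    then have "c \<in> X" "s c = s b" using fr flip False by blast+
    then obtain d where "(c, d) \<in> I" "(d, b) \<in> I" using common ab by blast
    with c show ?thesis unfolding relpow_3_iff by blast
  qed
  ultimately have plane: "plane1 X I"
    unfolding plane1_def frame1_def using fr o3 by (intro conjI) (blast | metis)+
  have cls: "(I ^^ 2) `` {a} = {b \<in> X. s b = s a}" if "a \<in> X" for a
    using that by (auto simp: I2)
  have "X // (I ^^ 2) = {{b \<in> X. \<not> s b}, {b \<in> X. s b}}"
  proof
    show "X // (I ^^ 2) \<subseteq> {{b \<in> X. \<not> s b}, {b \<in> X. s b}}"
    proof
      fix c assume "c \<in> X // (I ^^ 2)"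
      then obtain a where "a \<in> X" "c = (I ^^ 2) `` {a}" by (rule quotientE)
      with cls show "c \<in> {{b \<in> X. \<not> s b}, {b \<in> X. s b}}" by (cases "s a") auto
    qed
    have "{b \<in> X. \<not> s b} = (I ^^ 2) `` {p}" "{b \<in> X. s b} = (I ^^ 2) `` {q}"
      using cls p q by auto
    then show "{{b \<in> X. \<not> s b}, {b \<in> X. s b}} \<subseteq> X // (I ^^ 2)"
      using quotientI[OF p(1)] quotientI[OF q(1)] by auto
  qed
  moreover have "{b \<in> X. \<not> s b} \<noteq> {b \<in> X. s b}" using p by blast
  ultimately show ?thesis using plane unfolding projective_1_plane_def by simp
qed

instance fm :: countable
  by countable_datatype

text \<open>A path \<open>0 - 1 - 2 - 3\<close> and a separate edge \<open>4 - 5\<close>: exactly what non-degeneracy asks for.\<close>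

definition seed :: "nat \<Rightarrow> nat \<Rightarrow> bool" where
  "seed i j \<longleftrightarrow> i < 6 \<and> j < 6 \<and> (j = Suc i \<and> i \<noteq> 3 \<or> i = Suc j \<and> j \<noteq> 3)"

lemma seed_sym: "seed i j \<Longrightarrow> seed j i"
  unfolding seed_def by blast

lemma seed_no_quadrangle: "seed i j \<Longrightarrow> seed j k \<Longrightarrow> seed k l \<Longrightarrow> seed l i \<Longrightarrow> i = k \<or> j = l"
  unfolding seed_def by arith

lemma seed_parity: "seed i j \<Longrightarrow> even j \<longleftrightarrow> odd i"
  unfolding seed_def by auto

section \<open>Construction of a refuting plane from the canonical model\<close>

context logic_above_12g
begin

lemma canon2_sym: "(u, v) \<in> canon ^^ 2 \<Longrightarrow> (v, u) \<in> canon ^^ 2"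
  unfolding relpow_2_iff using canon_sym by (elim exE conjE) (intro exI conjI)

text \<open>The walk from \<open>q\<close> back to \<open>p\<close>, by two steps to
  \<open>u\<close> and on to \<open>v\<close> has length four and contracts to two. Thus an edge
  leads from the worlds around \<open>p\<close> to those around \<open>q\<close>.\<close>

lemma canon2_step:
  assumes "(p, q) \<in> canon" "(p, u) \<in> canon ^^ 2" "(u, v) \<in> canon"
  shows "(q, v) \<in> canon ^^ 2"
proof -
  from assms have "(q, v) \<in> canon ^^ 4"
    unfolding relpow_2_iff relpow_4_iff using canon_sym by blast
  then show ?thesis using canon_relpow_4 by blast
qed

lemma canon2_trans:
  assumes "(u, v) \<in> canon ^^ 2" "(v, w) \<in> canon ^^ 2"
  shows "(u, w) \<in> canon ^^ 2"
proof -
  from assms have "(u, w) \<in> canon ^^ 4" unfolding relpow_2_iff relpow_4_iff by blast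
  then show ?thesis using canon_relpow_4 by blast
qed

lemma refuted_in_nondegenerate_projective_1_plane:
  assumes inf: "infinite (UNIV :: 'w set)" and "\<phi> \<notin> L"
  shows "\<exists>X I. nondegenerate_projective_1_plane (X :: 'w set) I \<and> \<not> valid_on X I \<phi>"
proof -
  obtain e :: "nat \<Rightarrow> 'w" where e: "inj e" using infinite_countable_subset[OF inf] by blast
  obtain x where x: "world x" "\<phi> \<notin> x" using lindenbaum[OF mp_closed_L assms(2)] by blast
  obtain y where xy: "(x, y) \<in> canon" using canon_serial[OF x(1)] by blast
  define base where "base i = (if i then y else x)" for i
  have base: "(base i, base (\<not> i)) \<in> canon" for i using xy canon_sym unfolding base_def by auto
  \<comment> \<open>Copy \<open>False\<close> holds the worlds two steps from \<open>x\<close>, copy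
    \<open>True\<close> those two steps from \<open>y\<close>. The tag separates the copies even
    when a world lies in both, which makes \<open>J\<close> bipartite.\<close>
  define W where "W = {(u, i). (base i, u) \<in> canon ^^ 2}"
  define J where "J = {((u, i), (v, j)). (u, i) \<in> W \<and> (u, v) \<in> canon \<and> j = (\<not> i)}"
  \<comment> \<open>The number \<open>k\<close> codes a formula. The chosen successor refutes it if
    its box is missing from \<open>u\<close>; otherwise any successor serves.\<close>
  define h where "h k = (\<lambda>(u, i :: bool). (SOME v. (u, v) \<in> canon \<and>
    (Box (from_nat k) \<notin> u \<longrightarrow> from_nat k \<notin> v), \<not> i))" for k
  have W_step: "(v, \<not> i) \<in> W" if "(u, i) \<in> W" "(u, v) \<in> canon" for u v i
    using canon2_step[OF base] that unfolding W_def by auto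
  have W_world: "world u" if "(u, i) \<in> W" for u i
    using that unfolding W_def relpow_2_iff canon_def by auto
  have h: "(u, fst (h k (u, i))) \<in> canon \<and> (Box (from_nat k) \<notin> u \<longrightarrow> from_nat k \<notin> fst (h k (u, i)))"
    if "(u, i) \<in> W" for k u i
  proof -
    have "\<exists>v. (u, v) \<in> canon \<and> (Box (from_nat k) \<notin> u \<longrightarrow> from_nat k \<notin> v)"
      using canon_witness[OF W_world[OF that]] canon_serial[OF W_world[OF that]] by metis
    then show ?thesis unfolding h_def prod.case fst_conv by (rule someI_ex)
  qed
  interpret bipartite_labels e W J snd h
  proof
    show "inj e" by (rule e)
    show "J \<subseteq> W \<times> W" using W_step unfolding J_def by auto
    show "sym J" using W_step canon_sym unfolding J_def by (intro symI) auto
    show "snd v \<longleftrightarrow> \<not> snd u" if "(u, v) \<in> J" for u v using that unfolding J_def by auto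
    show "\<exists>w. (u, w) \<in> J \<and> (v, w) \<in> J" if uv: "u \<in> W" "v \<in> W" "snd u = snd v" for u v
    proof -
      \<comment> \<open>Equal tags put both worlds two steps from the same base world, hence two
        steps from each other; the middle world is the common successor.\<close>
      obtain a b i where ab: "u = (a, i)" "v = (b, i)" using uv(3) by (cases u; cases v) auto
      then have "(a, b) \<in> canon ^^ 2"
        using uv canon2_sym canon2_trans unfolding W_def by blast
      then obtain w where "(a, w) \<in> canon" "(b, w) \<in> canon"
        using canon_sym unfolding relpow_2_iff by blast
      then have "(u, (w, \<not> i)) \<in> J \<and> (v, (w, \<not> i)) \<in> J" using uv unfolding J_def ab by auto
      then show ?thesis by blast
    qed
    show "(u, h k u) \<in> J" if "u \<in> W" for u k
    proof -
      obtain a i where u: "u = (a, i)" by (cases u)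
      have "snd (h k u) = (\<not> i)" unfolding h_def u by simp
      then show ?thesis using h[of a i k] that unfolding u J_def by (cases "h k (a, i)") auto
    qed
  qed
  define D0 where "D0 = e ` {..<6}"
  define I0 where "I0 = {(e i, e j) | i j. seed i j}"
  \<comment> \<open>Labelling by parity sends every edge of the seed to the single edge between
    \<open>x\<close> and \<open>y\<close>.\<close>
  define f0 where "f0 a = (if even (inv e a) then (x, False) else (y, True))" for a
  have f0: "f0 (e i) = (if even i then (x, False) else (y, True))" for i
    unfolding f0_def using e by simp
  have I0: "(e i, e j) \<in> I0 \<longleftrightarrow> seed i j" for i j
    unfolding I0_def using e by (auto simp: inj_eq)
  have xW: "(x, False) \<in> W" and yW: "(y, True) \<in> W"
    using xy canon_sym[OF xy] unfolding W_def base_def relpow_2_iff by auto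
  have "good (D0, I0, f0)"
    unfolding good.simps
  proof (intro conjI allI impI)
    show "finite D0" "D0 \<subseteq> range e" unfolding D0_def by auto
    show "I0 \<subseteq> D0 \<times> D0" unfolding D0_def I0_def seed_def by auto
    show "sym I0" unfolding I0_def using seed_sym by (intro symI) blast
    show "f0 ` D0 \<subseteq> W" unfolding D0_def using f0 xW yW by auto
    show "(f0 a, f0 b) \<in> J" if "(a, b) \<in> I0" for a b
    proof -
      from that obtain i j where "a = e i" "b = e j" "seed i j" unfolding I0_def by blast
      then show ?thesis
        using f0 seed_parity[of i j] xW yW xy canon_sym[OF xy] unfolding J_def by auto
    qed
    show "a = c \<or> b = d"
      if "(a, b) \<in> I0 \<and> (b, c) \<in> I0 \<and> (c, d) \<in> I0 \<and> (d, a) \<in> I0" for a b c d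
    proof -
      from that obtain i j k l where ijkl: "a = e i" "b = e j" "c = e k" "d = e l"
        unfolding I0_def by blast
      from that have "seed i j" "seed j k" "seed k l" "seed l i" unfolding ijkl I0 by auto
      then show ?thesis unfolding ijkl using seed_no_quadrangle by blast
    qed
  qed
  then obtain X I f where D0: "D0 \<subseteq> X" "I \<inter> D0 \<times> D0 = I0" "\<forall>a\<in>D0. f a = f0 a"
    and fr: "I \<subseteq> X \<times> X" and fW: "f ` X \<subseteq> W" and fJ: "\<forall>a b. (a, b) \<in> I \<longrightarrow> (f a, f b) \<in> J"
    and o3: "\<forall>a b c d. (a, b) \<in> I \<longrightarrow> (b, c) \<in> I \<longrightarrow> (c, d) \<in> I \<longrightarrow> (d, a) \<in> I \<longrightarrow> a = c \<or> b = d"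
    and common: "\<forall>a\<in>X. \<forall>b\<in>X. snd (f a) = snd (f b) \<longrightarrow> (\<exists>c. (a, c) \<in> I \<and> (c, b) \<in> I)"
    and wit: "\<forall>a\<in>X. \<forall>k. \<exists>c. (a, c) \<in> I \<and> f c = h k (f a)"
    by (rule free_completion)
  have eX: "e i \<in> X" "f (e i) = f0 (e i)" if "i < 6" for i
    using D0(1,3) that unfolding D0_def by auto
  \<comment> \<open>The equivalence, not just one implication, is needed: non-degeneracy also
    demands non-incidences.\<close>
  have eI: "(e i, e j) \<in> I \<longleftrightarrow> seed i j" if "i < 6" "j < 6" for i j
    using D0(2) that I0[of i j] unfolding D0_def by blast
  have "projective_1_plane X I"
  proof (rule projective_1_plane_if_sides[where s = "\<lambda>a. snd (f a)" and p = "e 0" and q = "e 1"])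
    show "snd (f b) \<longleftrightarrow> \<not> snd (f a)" if "(a, b) \<in> I" for a b using J_side fJ that by blast
    show "\<exists>b. (a, b) \<in> I" if "a \<in> X" for a using wit that by blast
    show "\<not> snd (f (e 0))" "snd (f (e 1))" using eX f0 by auto
    show "\<exists>c. (a, c) \<in> I \<and> (c, b) \<in> I" if "a \<in> X" "b \<in> X" "snd (f a) = snd (f b)" for a b
      using common that by blast
    show "a = c \<or> b = d" if "(a, b) \<in> I" "(b, c) \<in> I" "(c, d) \<in> I" "(d, a) \<in> I" for a b c d
      using o3 that by blast
  qed (use fr eX in simp_all)
  moreover have "nondegenerate I"
    unfolding nondegenerate_def
    by (rule exI[of _ "e 0"], rule exI[of _ "e 1"], rule exI[of _ "e 2"], rule exI[of _ "e 3"],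
        rule exI[of _ "e 4"], rule exI[of _ "e 5"]) (simp add: eI, simp add: seed_def)
  moreover have "\<not> valid_on X I \<phi>"
  proof
    define V where "V p = {a \<in> X. Var p \<in> fst (f a)}" for p
    have wf: "world (fst (f a))" if "a \<in> X" for a
      using fW that W_world by (metis image_subset_iff prod.collapse)
    have truth: "sat I V a \<psi> \<longleftrightarrow> \<psi> \<in> fst (f a)" if "a \<in> X" for a \<psi>
      using that
    proof (induction \<psi> arbitrary: a)
      case (Var p)
      then show ?case unfolding V_def by simp
    next
      case (Neg \<psi>)
      then show ?case using wf unfolding world_def by simp
    next
      case (Conj \<psi> \<chi>)
      then show ?case using wf world_Conj by simp
    next
      case (Box \<psi>)
      show ?case
      proof
        assume "sat I V a (Box \<psi>)"
        then have all: "\<psi> \<in> fst (f b)" if "(a, b) \<in> I" for b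
          using that fr Box.IH by (metis SigmaD2 sat.simps(4) subsetD)
        show "Box \<psi> \<in> fst (f a)"
        proof (rule ccontr)
          assume no: "Box \<psi> \<notin> fst (f a)"
          \<comment> \<open>The neighbour supplied for the code of \<open>\<psi>\<close> is labelled
            by a world omitting \<open>\<psi>\<close>.\<close>
          obtain b where b: "(a, b) \<in> I" "f b = h (to_nat \<psi>) (f a)" using wit Box.prems by blast
          have "(fst (f a), snd (f a)) \<in> W" using fW Box.prems by auto
          from h[OF this, of "to_nat \<psi>"] no b(2) have "\<psi> \<notin> fst (f b)" by simp
          with all b(1) show False by blast
        qed
      next
        assume bx: "Box \<psi> \<in> fst (f a)"
        have "sat I V b \<psi>" if "(a, b) \<in> I" for b
        proof -
          have "(fst (f a), fst (f b)) \<in> canon" using fJ that unfolding J_def by fastforce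
          then have "\<psi> \<in> fst (f b)" using bx unfolding canon_def by blast
          then show ?thesis using Box.IH that fr by blast
        qed
        then show "sat I V a (Box \<psi>)" by simp
      qed
    qed
    assume "valid_on X I \<phi>"
    moreover have "V p \<subseteq> X" for p unfolding V_def by blast
    ultimately have "sat I V (e 0) \<phi>" using eX(1)[of 0] unfolding valid_on_def by simp
    then show False using truth[of "e 0" \<phi>] x(2) eX[of 0] f0[of 0] by simp
  qed
  ultimately show ?thesis unfolding nondegenerate_projective_1_plane_def by blast
qed

end

text \<open>All clauses for a normal logic are closure conditions and hence survive
  intersection.\<close>

lemma logic_above_12g_logic_12g: "logic_above_12g logic_12g"
proof
  show "normal_logic logic_12g" unfolding normal_logic_def logic_12g_def by blast
  show "axioms_12g \<subseteq> logic_12g" unfolding logic_12g_def by blast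
qed

theorem theorem6p2:
  fixes \<phi> :: fm
  assumes "infinite (UNIV :: 'w set)"
  shows
    "(\<phi> \<in> logic_12g \<longleftrightarrow> valid_in (quasi_1_plane :: 'w set \<Rightarrow> 'w rel \<Rightarrow> bool) \<phi>) \<and>
     (\<phi> \<in> logic_12g \<longleftrightarrow> valid_in (connected_quasi_1_plane :: 'w set \<Rightarrow> 'w rel \<Rightarrow> bool) \<phi>) \<and>
     (\<phi> \<in> logic_12g \<longleftrightarrow> valid_in (plane1 :: 'w set \<Rightarrow> 'w rel \<Rightarrow> bool) \<phi>) \<and>
     (\<phi> \<in> logic_12g \<longleftrightarrow> valid_in (projective_1_plane :: 'w set \<Rightarrow> 'w rel \<Rightarrow> bool) \<phi>) \<and>
     (\<phi> \<in> logic_12g \<longleftrightarrow> valid_in (nondegenerate_projective_1_plane :: 'w set \<Rightarrow> 'w rel \<Rightarrow> bool) \<phi>)"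
proof -
  have sound: "valid_in (K :: 'w set \<Rightarrow> 'w rel \<Rightarrow> bool) \<phi>"
    if "\<phi> \<in> logic_12g" "\<And>X I. K X I \<Longrightarrow> quasi_1_plane X I" for K
    using logic_12g_sound[OF that(1)] that(2) unfolding valid_in_def by blast
  have complete: "\<phi> \<in> logic_12g"
    if valid: "valid_in (K :: 'w set \<Rightarrow> 'w rel \<Rightarrow> bool) \<phi>"
      and K: "\<And>X I. nondegenerate_projective_1_plane X I \<Longrightarrow> K X I" for K
  proof (rule ccontr)
    interpret logic_above_12g logic_12g by (rule logic_above_12g_logic_12g)
    assume "\<phi> \<notin> logic_12g"
    from refuted_in_nondegenerate_projective_1_plane[OF assms this] valid K show False
      unfolding valid_in_def by blast
  qed
  \<comment> \<open>All five classes lie between the non-degenerate projective planes and the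
    quasi-1-planes, so soundness for the largest and completeness for the smallest settle every
    equivalence.\<close>
  have char: "\<phi> \<in> logic_12g \<longleftrightarrow> valid_in (K :: 'w set \<Rightarrow> 'w rel \<Rightarrow> bool) \<phi>"
    if "\<And>X I. K X I \<Longrightarrow> quasi_1_plane X I"
      "\<And>X I. nondegenerate_projective_1_plane X I \<Longrightarrow> K X I" for K
    using sound complete that by blast
  have np: "projective_1_plane X I" if "nondegenerate_projective_1_plane X I" for X :: "'w set" and I
    using that unfolding nondegenerate_projective_1_plane_def by blast
  have pp: "plane1 X I" if "projective_1_plane X I" for X :: "'w set" and I
    using that unfolding projective_1_plane_def by blast
  have cq: "quasi_1_plane X I" if "connected_quasi_1_plane X I" for X :: "'w set" and I
    using that unfolding connected_quasi_1_plane_def by blast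
  note pc = plane1_imp_connected_quasi_1_plane
  show ?thesis
    by (intro conjI; rule char) (meson np pp cq pc)+
qed

end
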